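(* Let $f:\{0,1\}^n\to\{0,1\}$ be given by $f(X)=1$ if $|X|=\lfloor n/2\rfloor+1$ and $f(X)=0$ otherwise. Then every NN representation of $f$ with $3$ anchors has resolution $\Omega(\log n)$.
   Context: $|X|$ is the number of ones in $X$; $d$ is Euclidean distance. An NN representation of $f$ is a pair of disjoint finite sets $P,N\subset\mathbb{R}^n$ (anchors) such that for every $X$ with $f(X)=1$ there is $p\in P$ with $d(X,p)<d(X,q)$ for all $q\in N$, and for every $X$ with $f(X)=0$ there is $q\in N$ with $d(X,q)<d(X,p)$ for all $p\in P$. Anchors may be assumed rational. The resolution of a rational $a/b$ ($a,b\in\mathbb{Z}$ coprime, $b\ne0$) is $RES(a/b)=\lceil\max\{\log_2|a+1|,\log_2|b+1|\}\rceil$; the resolution of an NN representation is the maximum resolution over all entries of all anchors. *)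

theory Defs
  imports Complex_Main "HOL-Analysis.L2_Norm" "Jordan_Normal_Form.Matrix"
begin

text \<open>Since the asymptotic claim quantifies over the dimension, \<open>\<real>\<^sup>n\<close> is rendered as
  \<^term>\<open>carrier_vec n :: real vec set\<close>.\<close>

definition cube :: "nat \<Rightarrow> real vec set" where
  "cube n = {X \<in> carrier_vec n. \<forall>i<n. X $ i \<in> {0, 1}}"

definition num_ones :: "real vec \<Rightarrow> nat" where
  "num_ones X = card {i. i < dim_vec X \<and> X $ i = 1}"

definition euclid_dist :: "real vec \<Rightarrow> real vec \<Rightarrow> real" where
  "euclid_dist x y = L2_set (\<lambda>i. x $ i - y $ i) {..<dim_vec x}"

definition NN_representation ::
  "nat \<Rightarrow> (real vec \<Rightarrow> nat) \<Rightarrow> real vec set \<Rightarrow> real vec set \<Rightarrow> bool" where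
  "NN_representation n f P N \<longleftrightarrow>
     finite P \<and> finite N \<and> P \<subseteq> carrier_vec n \<and> N \<subseteq> carrier_vec n \<and> P \<inter> N = {} \<and>
     (\<forall>X\<in>cube n. f X = 1 \<longrightarrow> (\<exists>p\<in>P. \<forall>q\<in>N. euclid_dist X p < euclid_dist X q)) \<and>
     (\<forall>X\<in>cube n. f X = 0 \<longrightarrow> (\<exists>q\<in>N. \<forall>p\<in>P. euclid_dist X q < euclid_dist X p))"

definition rational_vec :: "real vec \<Rightarrow> bool" where
  "rational_vec v \<longleftrightarrow> (\<forall>i<dim_vec v. v $ i \<in> \<rat>)"

text \<open>\<^const>\<open>quotient_of\<close> returns the coprime pair with positive denominator \<open>b\<close>, so that
  \<open>log 2 \<bar>b + 1\<bar> \<ge> 1\<close>.  Hence for \<open>a = -1\<close> the maximum is the same whether \<open>log 2 0\<close> is read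
  as \<open>-\<infinity>\<close> or, as in the library, as \<open>0\<close>.\<close>

definition RES :: "rat \<Rightarrow> int" where
  "RES r = (case quotient_of r of (a, b) \<Rightarrow>
     \<lceil>max (log 2 \<bar>real_of_int (a + 1)\<bar>) (log 2 \<bar>real_of_int (b + 1)\<bar>)\<rceil>)"

text \<open>Only meaningful when all anchors satisfy \<^const>\<open>rational_vec\<close>.\<close>

definition NN_resolution :: "real vec set \<Rightarrow> real vec set \<Rightarrow> int" where
  "NN_resolution P N =
     Max {RES r | r v i. v \<in> P \<union> N \<and> i < dim_vec v \<and> v $ i = of_rat r}"

definition exact_level :: "nat \<Rightarrow> real vec \<Rightarrow> nat" where
  "exact_level n X = (if num_ones X = n div 2 + 1 then 1 else 0)"

end

theory Submission imports Defs begin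

text \<open>Let \<open>R\<close> be the resolution and \<open>M = 2\<^sup>R\<close>; the claim follows from \<open>n \<le> M\<^bsup>26\<^esup>\<close>.

  With two positive anchors, each of the two halfspaces contains at most one vertex of the
  level, because \<open>X + Y = (X \<union> Y) + (X \<inter> Y)\<close>; but the level has at least three vertices.

  With anchors \<open>p\<close> (positive) and \<open>q, r\<close> (negative), the level is cut out by two halfspaces with
  normals \<open>p - q\<close> and \<open>p - r\<close>.  If \<open>n\<close> exceeds a power of \<open>M\<close>, then many coordinates share one
  triple of anchor entries.  Varying a level vertex on such coordinates shows that the normals
  take there constant values \<open>\<alpha>, \<beta>\<close> of opposite signs and that both margins stay below \<open>\<bar>\<alpha>\<bar>\<close> and
  \<open>\<bar>\<beta>\<bar>\<close>.  Exchange arguments then force the normals to equal \<open>\<alpha>\<close> and \<open>\<beta>\<close> on all but polynomially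
  many (in \<open>M\<close>) coordinates.  In the combination of the margins with weights \<open>\<bar>\<beta>\<bar>\<close> and \<open>\<bar>\<alpha>\<bar>\<close> the
  linear terms cancel on these coordinates, while the quadratic terms (half the squared lengths
  of the normals) grow linearly in \<open>n\<close>, which contradicts the bounds on the margins.\<close>

definition fractions :: "nat \<Rightarrow> real set" where
  "fractions D = {of_int a / of_nat b | a b. 1 \<le> b \<and> b \<le> D}"

lemma fractions_diff:
  assumes "x \<in> fractions D" "y \<in> fractions E"
  shows "x - y \<in> fractions (D * E)"
proof -
  obtain a b where x: "x = of_int a / of_nat b" "1 \<le> b" "b \<le> D"
    using assms(1) by (auto simp: fractions_def)
  obtain c d where y: "y = of_int c / of_nat d" "1 \<le> d" "d \<le> E"
    using assms(2) by (auto simp: fractions_def)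
  have "x - y = of_int (a * int d - c * int b) / of_nat (b * d)"
    using x(2) y(2) unfolding x(1) y(1) by (simp add: field_simps)
  moreover have "1 \<le> b * d" "b * d \<le> D * E"
    using x y by (simp_all add: mult_le_mono)
  ultimately show ?thesis unfolding fractions_def by blast
qed

lemma fractions_abs_ge:
  assumes "x \<in> fractions D" "x \<noteq> 0"
  shows "1 / real D \<le> \<bar>x\<bar>"
proof -
  obtain a b where x: "x = of_int a / of_nat b" "1 \<le> b" "b \<le> D"
    using assms(1) by (auto simp: fractions_def)
  with assms(2) have "1 \<le> \<bar>real_of_int a\<bar>" by auto
  then have "1 / real D \<le> \<bar>real_of_int a\<bar> / real b"
    using x by (intro frac_le) auto
  with x show ?thesis by simp
qed

definition bounded_fractions :: "nat \<Rightarrow> real set" where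
  "bounded_fractions M = {x \<in> fractions M. \<bar>x\<bar> \<le> 2 * real M}"

lemma bounded_fractions_card:
  "finite (bounded_fractions M) \<and> card (bounded_fractions M) \<le> (4 * M\<^sup>2 + 1) * M"
proof -
  define S where "S = {- 2 * int M * int M .. 2 * int M * int M} \<times> {1..M}"
  let ?g = "\<lambda>(a, b). real_of_int a / real b"
  have sub: "bounded_fractions M \<subseteq> ?g ` S"
  proof
    fix x assume "x \<in> bounded_fractions M"
    then obtain a b where x: "x = of_int a / of_nat b" "1 \<le> b" "b \<le> M" "\<bar>x\<bar> \<le> 2 * real M"
      by (auto simp: fractions_def bounded_fractions_def)
    then have "\<bar>real_of_int a\<bar> = \<bar>x\<bar> * real b" by (simp add: abs_divide)
    also have "\<dots> \<le> 2 * real M * real b" using x by (intro mult_right_mono) auto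
    also have "\<dots> \<le> 2 * real M * real M" using x by (intro mult_left_mono) auto
    finally have "\<bar>real_of_int a\<bar> \<le> real_of_int (2 * int M * int M)" by simp
    then have "\<bar>a\<bar> \<le> 2 * int M * int M" by linarith
    then have "(a, b) \<in> S" using x by (auto simp: S_def)
    then show "x \<in> ?g ` S" using x by force
  qed
  have fin: "finite S" by (simp add: S_def)
  have "nat (2 * int M * int M + 1 - (- 2 * int M * int M)) = 4 * M\<^sup>2 + 1"
    by (simp add: power2_eq_square nat_eq_iff)
  then have "card S = (4 * M\<^sup>2 + 1) * M"
    by (simp add: S_def card_cartesian_product)
  then show ?thesis
    using sub fin card_mono[OF finite_imageI[OF fin] sub] card_image_le[OF fin, of ?g]
    by (auto intro: finite_subset)
qed

lemma pigeonhole_fibre: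
  assumes "finite A" "finite B" "f ` A \<subseteq> B" "card B * m < card A"
  shows "\<exists>y\<in>B. m < card {x \<in> A. f x = y}"
proof (rule ccontr)
  assume neg: "\<not> ?thesis"
  have "A = (\<Union>y\<in>B. {x \<in> A. f x = y})" using assms(3) by auto
  then have "card A \<le> (\<Sum>y\<in>B. card {x \<in> A. f x = y})"
    using card_UN_le[OF assms(2), of "\<lambda>y. {x \<in> A. f x = y}"] by simp
  also have "\<dots> \<le> card B * m"
    using neg sum_bounded_above[of B "\<lambda>y. card {x \<in> A. f x = y}" m] by (simp add: not_less)
  finally show False using assms(4) by simp
qed

text \<open>Half the difference of the squared distances of the vertex with support \<open>A\<close>
  to \<open>q\<close> and to \<open>p\<close>.\<close>

definition margin :: "nat \<Rightarrow> (nat \<Rightarrow> real) \<Rightarrow> (nat \<Rightarrow> real) \<Rightarrow> nat set \<Rightarrow> real" where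
  "margin n p q A = (\<Sum>i\<in>A. p i - q i) - (\<Sum>i<n. ((p i)\<^sup>2 - (q i)\<^sup>2) / 2)"

lemma margin_swap: "margin n q p A = - margin n p q A"
  by (simp add: margin_def sum_subtractf flip: sum_divide_distrib) (simp add: field_simps)

lemma margin_insert:
  assumes "finite A" "i \<notin> A"
  shows "margin n p q (insert i A) = margin n p q A + (p i - q i)"
  using assms by (simp add: margin_def)

lemma margin_remove:
  assumes "finite A" "i \<in> A"
  shows "margin n p q (A - {i}) = margin n p q A - (p i - q i)"
  using assms by (simp add: margin_def sum_diff1)

lemma margin_Un_disjoint:
  assumes "finite A" "finite B" "A \<inter> B = {}"
  shows "margin n p q (A \<union> B) = margin n p q A + (\<Sum>i\<in>B. p i - q i)"
  using assms by (simp add: margin_def sum.union_disjoint)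

lemma margin_Un_Int:
  assumes "finite A" "finite B"
  shows "margin n p q (A \<union> B) + margin n p q (A \<inter> B) = margin n p q A + margin n p q B"
  using sum.union_inter[OF assms, of "\<lambda>i. p i - q i"] by (simp add: margin_def)

lemma margin_centered:
  assumes "A \<subseteq> {..<n}"
  shows "margin n p q A =
    (\<Sum>i<n. (of_bool (i \<in> A) - p i) * (p i - q i) + (p i - q i)\<^sup>2 / 2)"
proof -
  have "(\<Sum>i\<in>A. p i - q i) = (\<Sum>i<n. of_bool (i \<in> A) * (p i - q i))"
    using assms by (simp add: sum.inter_restrict[symmetric] Int_absorb1 of_bool_def
        if_distrib[of "\<lambda>x. x * _"] cong: if_cong)
  then show ?thesis
    unfolding margin_def by (simp add: algebra_simps power2_eq_square diff_divide_distrib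
        add_divide_distrib flip: sum_subtractf)
qed

definition vertex :: "nat \<Rightarrow> nat set \<Rightarrow> real vec" where
  "vertex n A = vec n (\<lambda>i. of_bool (i \<in> A))"

lemma vertex_in_cube: "vertex n A \<in> cube n"
  by (auto simp: vertex_def cube_def)

lemma num_ones_vertex:
  assumes "A \<subseteq> {..<n}"
  shows "num_ones (vertex n A) = card A"
proof -
  have "{i. i < dim_vec (vertex n A) \<and> vertex n A $ i = 1} = A"
    using assms by (auto simp: vertex_def)
  then show ?thesis by (simp add: num_ones_def)
qed

lemma euclid_dist_vertex_less_iff:
  assumes "A \<subseteq> {..<n}"
  shows "euclid_dist (vertex n A) u < euclid_dist (vertex n A) v
    \<longleftrightarrow> 0 < margin n (($) u) (($) v) A"
proof -
  let ?x = "\<lambda>i. of_bool (i \<in> A) :: real"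
  have "euclid_dist (vertex n A) u < euclid_dist (vertex n A) v \<longleftrightarrow>
     (\<Sum>i<n. (?x i - u $ i)\<^sup>2) < (\<Sum>i<n. (?x i - v $ i)\<^sup>2)"
    by (simp add: euclid_dist_def L2_set_def vertex_def)
  also have "(\<Sum>i<n. (?x i - v $ i)\<^sup>2) = (\<Sum>i<n. (?x i - u $ i)\<^sup>2)
     + 2 * margin n (($) u) (($) v) A"
    unfolding margin_centered[OF assms] sum_distrib_left sum.distrib[symmetric]
    by (intro sum.cong) (auto simp: power2_eq_square field_simps)
  finally show ?thesis by simp
qed

text \<open>A halfspace that contains two vertices of a level contains their union or their
  intersection, so it cannot isolate vertices of that level.\<close>

lemma isolated_level_set_unique:
  assumes "finite X" "finite Y" "card X = k" "card Y = k"
    and "0 < margin n p q X" "0 < margin n p q Y"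
    and "\<And>Z. Z \<subseteq> X \<union> Y \<Longrightarrow> card Z \<noteq> k \<Longrightarrow> margin n p q Z \<le> 0"
  shows "X = Y"
proof (rule ccontr)
  assume "X \<noteq> Y"
  then have *: "\<not> X \<subseteq> Y" "\<not> Y \<subseteq> X"
    using assms(1-4) by (metis card_subset_eq)+
  have "card X < card (X \<union> Y)" "card (X \<inter> Y) < card X"
    using * assms(1,2) by (auto intro!: psubset_card_mono)
  then have "margin n p q (X \<union> Y) \<le> 0" "margin n p q (X \<inter> Y) \<le> 0"
    using assms(3,4) by (auto intro!: assms(7))
  then show False using margin_Un_Int[OF assms(1,2), of n p q] assms(5,6) by linarith
qed

locale level_between_halfspaces =
  fixes n k :: nat and p q r :: "nat \<Rightarrow> real"
  assumes level_pos: "X \<subseteq> {..<n} \<Longrightarrow> card X = k \<Longrightarrow> 0 < margin n p q X \<and> 0 < margin n p r X"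
    and off_level_neg:
      "X \<subseteq> {..<n} \<Longrightarrow> card X \<noteq> k \<Longrightarrow> margin n p q X < 0 \<or> margin n p r X < 0"
begin

lemma level_between_halfspaces_swap: "level_between_halfspaces n k p r q"
  using level_pos off_level_neg by unfold_locales blast+

text \<open>Removing \<open>c\<close> and adding \<open>d\<close> change each margin by opposite amounts, so the two
  neighbours of \<open>X\<close> are cut off by different halfspaces.\<close>

lemma margin_bounds:
  assumes X: "X \<subseteq> {..<n}" "card X = k" and c: "c \<in> X" and d: "d < n" "d \<notin> X"
    and eq: "p c - q c = \<alpha>" "p d - q d = \<alpha>" "p c - r c = \<beta>" "p d - r d = \<beta>"
  shows "margin n p q X < \<bar>\<alpha>\<bar>" "margin n p r X < \<bar>\<beta>\<bar>" "\<alpha> * \<beta> < 0"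
proof -
  have fin: "finite X" using X(1) finite_subset by blast
  have "0 < k" using X(2) c fin by (auto simp: card_gt_0_iff)
  then have "card (X - {c}) \<noteq> k" "card (insert d X) \<noteq> k"
    using X(2) c d fin by auto
  moreover have "X - {c} \<subseteq> {..<n}" "insert d X \<subseteq> {..<n}" using X d by auto
  ultimately have "margin n p q X < \<alpha> \<or> margin n p r X < \<beta>"
    "margin n p q X < - \<alpha> \<or> margin n p r X < - \<beta>"
    using off_level_neg[of "X - {c}"] off_level_neg[of "insert d X"] c d fin eq
    by (auto simp: margin_insert margin_remove)
  moreover have "0 < margin n p q X" "0 < margin n p r X" using level_pos[OF X] by auto
  ultimately have "margin n p q X < \<bar>\<alpha>\<bar> \<and> margin n p r X < \<bar>\<beta>\<bar> \<and> (\<alpha> < 0 \<and> 0 < \<beta> \<or> 0 < \<alpha> \<and> \<beta> < 0)"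
    by linarith
  then show "margin n p q X < \<bar>\<alpha>\<bar>" "margin n p r X < \<bar>\<beta>\<bar>" "\<alpha> * \<beta> < 0"
    by (auto simp: mult_less_0_iff)
qed

text \<open>Exchanging \<open>D\<close> for equally many elements of \<open>C\<close> stays in the level and inside
  the bounds of \<open>margin_bounds\<close>.\<close>

lemma exchange_sum_less:
  assumes C: "C \<subseteq> {..<n}" "card D + 2 \<le> card C"
    and eq: "\<And>i. i \<in> C \<Longrightarrow> p i - q i = \<alpha> \<and> p i - r i = \<beta>"
    and D: "D \<subseteq> {..<n}" "D \<inter> C = {}"
    and k: "card D + 1 \<le> k" "k + card D + 1 \<le> n"
  shows "\<bar>\<Sum>i\<in>D. p i - q i - \<alpha>\<bar> < \<bar>\<alpha>\<bar>"
proof -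
  have finC: "finite C" and finD: "finite D" using C D finite_subset by blast+
  obtain C1 where C1: "C1 \<subseteq> C" "card C1 = card D" "finite C1"
    using C(2) obtain_subset_with_card_n[of "card D" C] by force
  have "card (C - C1) = card C - card D" using C1 by (simp add: card_Diff_subset)
  then have "2 \<le> card (C - C1)" using C(2) by linarith
  then obtain T where T: "T \<subseteq> C - C1" "card T = 2"
    using obtain_subset_with_card_n by metis
  then obtain c d where cd: "T = {c, d}" "c \<noteq> d" by (meson card_2_iff)
  let ?U = "C1 \<union> D \<union> T"
  have finT: "finite T" using cd by simp
  have "card ?U \<le> card C1 + card D + 2"
    using T(2) card_Un_le[of C1 D] card_Un_le[of "C1 \<union> D" T] by linarith
  moreover have "?U \<subseteq> {..<n}" using C1 C D T by auto
  ultimately have "n - (2 * card D + 2) \<le> card ({..<n} - ?U)"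
    using C1 finD finT by (simp add: card_Diff_subset)
  then have "k - (card D + 1) \<le> card ({..<n} - ?U)" using k by linarith
  then obtain E where E: "E \<subseteq> {..<n} - ?U" "card E = k - (card D + 1)" "finite E"
    by (metis obtain_subset_with_card_n)
  let ?F = "insert c E"
  have F: "finite ?F" "?F \<inter> C1 = {}" "?F \<inter> D = {}" "d \<notin> ?F" "c \<notin> E"
    using E(1,3) T cd D(2) by auto
  have cF: "card ?F = k - card D"
    using F(5) E(2,3) k(1) by simp
  have cX: "card (?F \<union> C1) = k" "card (?F \<union> D) = k"
    using F(1-3) cF C1 finD k(1) by (simp_all add: card_Un_disjoint del: Un_insert_left)
  have sub: "?F \<union> C1 \<subseteq> {..<n}" "?F \<union> D \<subseteq> {..<n}" "d < n" "d \<notin> ?F \<union> C1" "d \<notin> ?F \<union> D"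
    using E C1 C D T cd by auto
  have cdC: "p c - q c = \<alpha>" "p d - q d = \<alpha>" "p c - r c = \<beta>" "p d - r d = \<beta>"
    using eq[of c] eq[of d] T cd by auto
  have b: "margin n p q (?F \<union> C1) < \<bar>\<alpha>\<bar>" "margin n p q (?F \<union> D) < \<bar>\<alpha>\<bar>"
    using margin_bounds(1)[OF sub(1) cX(1) _ sub(3,4) cdC]
      margin_bounds(1)[OF sub(2) cX(2) _ sub(3,5) cdC] by auto
  have pos: "0 < margin n p q (?F \<union> C1)" "0 < margin n p q (?F \<union> D)"
    using level_pos cX sub by auto
  have "(\<Sum>i\<in>C1. p i - q i) = (\<Sum>i\<in>C1. \<alpha>)"
    using eq C1 by (intro sum.cong) auto
  then have "margin n p q (?F \<union> D) - margin n p q (?F \<union> C1) = (\<Sum>i\<in>D. p i - q i - \<alpha>)"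
    using F C1 finD by (simp add: margin_Un_disjoint sum_subtractf del: Un_insert_left)
  then show ?thesis using b pos by linarith
qed

lemma deviating_card_less:
  assumes C: "C \<subseteq> {..<n}" "L + 2 \<le> card C"
    and eq: "\<And>i. i \<in> C \<Longrightarrow> p i - q i = \<alpha> \<and> p i - r i = \<beta>"
    and k: "L + 1 \<le> k" "k + L + 1 \<le> n"
    and gap: "\<And>i. i < n \<Longrightarrow> p i - q i \<noteq> \<alpha> \<Longrightarrow> \<delta> \<le> \<bar>p i - q i - \<alpha>\<bar>"
    and L: "\<bar>\<alpha>\<bar> \<le> real L * \<delta>"
  shows "card {i. i < n \<and> p i - q i \<noteq> \<alpha>} < 2 * L"
proof (rule ccontr)
  let ?w = "\<lambda>i. p i - q i - \<alpha>"
  let ?U = "{i. i < n \<and> ?w i > 0}" and ?V = "{i. i < n \<and> ?w i < 0}"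
  have small: False if D: "D \<subseteq> {..<n}" "card D = L" "real L * \<delta> \<le> \<bar>sum ?w D\<bar>"
      "\<And>i. i \<in> D \<Longrightarrow> ?w i \<noteq> 0" for D
  proof -
    have "D \<inter> C = {}" using D(4) eq by auto
    then have "\<bar>sum ?w D\<bar> < \<bar>\<alpha>\<bar>"
      using exchange_sum_less[OF C(1) _ eq D(1)] C k D(2) by auto
    with D L show False by linarith
  qed
  assume "\<not> ?thesis"
  moreover have "{i. i < n \<and> p i - q i \<noteq> \<alpha>} = ?U \<union> ?V" by auto
  ultimately have "2 * L \<le> card ?U + card ?V" using card_Un_le[of ?U ?V] by simp
  then have "L \<le> card ?U \<or> L \<le> card ?V" by linarith
  then show False
  proof
    assume 1: "L \<le> card ?U"
    obtain D where D: "D \<subseteq> ?U" "card D = L" by (rule obtain_subset_with_card_n[OF 1])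
    have "real (card D) * \<delta> \<le> sum ?w D"
    proof (rule sum_bounded_below)
      fix i assume "i \<in> D"
      then have "i < n" "?w i > 0" using D(1) by auto
      then show "\<delta> \<le> ?w i" using gap[of i] by linarith
    qed
    with D show False by (intro small[of D]) auto
  next
    assume 2: "L \<le> card ?V"
    obtain D where D: "D \<subseteq> ?V" "card D = L" by (rule obtain_subset_with_card_n[OF 2])
    have "real (card D) * \<delta> \<le> sum (\<lambda>i. - ?w i) D"
    proof (rule sum_bounded_below)
      fix i assume "i \<in> D"
      then have "i < n" "?w i < 0" using D(1) by auto
      then show "\<delta> \<le> - ?w i" using gap[of i] by linarith
    qed
    then have "real (card D) * \<delta> \<le> - sum ?w D" by (simp only: sum_negf)
    with D show False by (intro small[of D]) auto
  qed
qed

text \<open>Where both weight vectors take their typical values \<open>\<alpha>\<close> and \<open>\<beta>\<close>, the linear parts of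
  \<open>\<bar>\<beta>\<bar> * margin n p q X + \<bar>\<alpha>\<bar> * margin n p r X\<close> cancel and the quadratic parts add up.\<close>

lemma weighted_margin_ge:
  assumes X: "X \<subseteq> {..<n}" and ab: "\<alpha> * \<beta> < 0" and B: "B \<subseteq> {..<n}"
    and typical: "\<And>i. i < n \<Longrightarrow> i \<notin> B \<Longrightarrow> p i - q i = \<alpha> \<and> p i - r i = \<beta>"
    and small: "\<And>i. i < n \<Longrightarrow> \<bar>p i - q i\<bar> \<le> K \<and> \<bar>p i - r i\<bar> \<le> K \<and> \<bar>of_bool (i \<in> X) - p i\<bar> \<le> K"
    and K: "\<bar>\<alpha>\<bar> \<le> K" "\<bar>\<beta>\<bar> \<le> K"
    and \<epsilon>: "\<epsilon> \<le> \<bar>\<alpha>\<bar>" "\<epsilon> \<le> \<bar>\<beta>\<bar>"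
  shows "(real n - real (card B)) * (\<bar>\<alpha>\<bar> * \<bar>\<beta>\<bar> * \<epsilon>) - real (card B) * (2 * K ^ 3)
    \<le> \<bar>\<beta>\<bar> * margin n p q X + \<bar>\<alpha>\<bar> * margin n p r X"
proof -
  let ?x = "\<lambda>i. of_bool (i \<in> X) - p i"
  let ?g = "\<lambda>i. \<bar>\<beta>\<bar> * (?x i * (p i - q i) + (p i - q i)\<^sup>2 / 2)
    + \<bar>\<alpha>\<bar> * (?x i * (p i - r i) + (p i - r i)\<^sup>2 / 2)"
  have K0: "0 \<le> K" using K by linarith
  have cancel: "\<bar>\<beta>\<bar> * \<alpha> + \<bar>\<alpha>\<bar> * \<beta> = 0"
    using ab by (auto simp: mult_less_0_iff)
  have typical_ge: "\<bar>\<alpha>\<bar> * \<bar>\<beta>\<bar> * \<epsilon> \<le> ?g i" if "i \<in> {..<n} - B" for i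
  proof -
    have eq: "p i - q i = \<alpha>" "p i - r i = \<beta>" using typical that by auto
    have "?g i = ?x i * (\<bar>\<beta>\<bar> * \<alpha> + \<bar>\<alpha>\<bar> * \<beta>) + (\<bar>\<beta>\<bar> * \<bar>\<alpha>\<bar>\<^sup>2 + \<bar>\<alpha>\<bar> * \<bar>\<beta>\<bar>\<^sup>2) / 2"
      unfolding eq power2_abs by (simp only: distrib_left add_divide_distrib mult.assoc
          mult.left_commute times_divide_eq_right add.assoc add.left_commute)
    also have "\<dots> = \<bar>\<alpha>\<bar> * \<bar>\<beta>\<bar> * ((\<bar>\<alpha>\<bar> + \<bar>\<beta>\<bar>) / 2)"
      unfolding cancel by (simp add: power2_eq_square algebra_simps add_divide_distrib)
    also have "\<dots> \<ge> \<bar>\<alpha>\<bar> * \<bar>\<beta>\<bar> * \<epsilon>"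
      using \<epsilon> by (intro mult_left_mono) auto
    finally show ?thesis .
  qed
  have term_ge: "- (K ^ 3) \<le> c * (y * w + w\<^sup>2 / 2)"
    if "0 \<le> c" "c \<le> K" "\<bar>y\<bar> \<le> K" "\<bar>w\<bar> \<le> K" for c y w :: real
  proof -
    have "\<bar>c * (y * w)\<bar> \<le> K * (K * K)"
      unfolding abs_mult using that K0 by (intro mult_mono) auto
    moreover have "0 \<le> c * (w\<^sup>2 / 2)" using that by simp
    ultimately show ?thesis by (simp add: power3_eq_cube algebra_simps abs_le_iff)
  qed
  have bad: "- (2 * K ^ 3) \<le> ?g i" if "i \<in> B" for i
  proof -
    have "i < n" using B that by auto
    then show ?thesis
      using term_ge[of "\<bar>\<beta>\<bar>" "?x i" "p i - q i"] term_ge[of "\<bar>\<alpha>\<bar>" "?x i" "p i - r i"]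
        small[of i] K by linarith
  qed
  have fin: "finite B" using B finite_subset by blast
  have "real (card ({..<n} - B)) * (\<bar>\<alpha>\<bar> * \<bar>\<beta>\<bar> * \<epsilon>) \<le> sum ?g ({..<n} - B)"
    by (intro sum_bounded_below typical_ge)
  moreover have "real (card B) * (- (2 * K ^ 3)) \<le> sum ?g B"
    by (intro sum_bounded_below bad)
  moreover have "sum ?g {..<n} = sum ?g ({..<n} - B) + sum ?g B"
    using B by (intro sum.subset_diff) auto
  moreover have "card B \<le> n" using card_mono[OF _ B] by simp
  then have "real (card ({..<n} - B)) = real n - real (card B)"
    using B fin by (simp add: card_Diff_subset)
  moreover have "sum ?g {..<n} = \<bar>\<beta>\<bar> * margin n p q X + \<bar>\<alpha>\<bar> * margin n p r X"
    unfolding margin_centered[OF X] by (simp only: sum.distrib flip: sum_distrib_left)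
  ultimately show ?thesis by simp
qed

lemma dimension_le_power:
  assumes k: "k = n div 2 + 1" and M: "2 \<le> M"
    and p: "\<And>i. i < n \<Longrightarrow> p i \<in> bounded_fractions M"
    and q: "\<And>i. i < n \<Longrightarrow> q i \<in> bounded_fractions M"
    and r: "\<And>i. i < n \<Longrightarrow> r i \<in> bounded_fractions M"
  shows "n \<le> M ^ 26"
proof (rule ccontr)
  assume "\<not> ?thesis"
  then have large: "M ^ 26 < n" by simp
  define L where "L = 4 * M ^ 5"
  have M12: "4096 \<le> M ^ 12" using power_mono[OF M, of 12] by simp
  have M14: "4096 * M ^ 14 < n"
  proof -
    have "4096 * M ^ 14 \<le> M ^ 12 * M ^ 14" using M12 by (rule mult_right_mono) simp
    also have "\<dots> = M ^ 26" by (simp flip: power_add)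
    finally show ?thesis using large by simp
  qed
  have pow14: "M ^ j \<le> M ^ 14" if "j \<le> 14" for j
    using M that by (intro power_increasing) auto
  have one: "1 \<le> M ^ j" for j using M by simp
  have Lk: "L + 1 \<le> k" "k + L + 1 \<le> n"
    using M14 pow14[of 5] one[of 14] unfolding L_def k by linarith+
  let ?S = "bounded_fractions M"
  have "card ?S \<le> 5 * M ^ 3"
  proof -
    have "(4 * M\<^sup>2 + 1) * M \<le> (5 * M\<^sup>2) * M"
      using one[of 2] by (intro mult_right_mono) simp_all
    also have "\<dots> = 5 * M ^ 3" by (simp add: power3_eq_cube power2_eq_square)
    finally show ?thesis using bounded_fractions_card[of M] by linarith
  qed
  then have "(card ?S) ^ 3 \<le> (5 * M ^ 3) ^ 3" by (rule power_mono) simp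
  also have "\<dots> = 125 * M ^ 9" by (simp add: power_mult_distrib flip: power_mult)
  finally have "card (?S \<times> ?S \<times> ?S) \<le> 125 * M ^ 9"
    by (simp add: card_cartesian_product power3_eq_cube mult.assoc)
  then have "card (?S \<times> ?S \<times> ?S) * (L + 1) \<le> (125 * M ^ 9) * (5 * M ^ 5)"
    using one[of 5] by (intro mult_mono) (simp_all add: L_def)
  also have "\<dots> = 625 * M ^ 14" by (simp flip: power_add)
  also have "\<dots> < card {..<n}" using M14 one[of 14] by simp
  finally have "\<exists>y\<in>?S \<times> ?S \<times> ?S. L + 1 < card {i \<in> {..<n}. (p i, q i, r i) = y}"
    using p q r bounded_fractions_card[of M] by (intro pigeonhole_fibre) auto
  then obtain a b c where "L + 1 < card {i \<in> {..<n}. (p i, q i, r i) = (a, b, c)}"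
    by auto
  then obtain C where C: "C \<subseteq> {..<n}" "L + 2 \<le> card C"
    and abc: "\<And>i. i \<in> C \<Longrightarrow> p i = a \<and> q i = b \<and> r i = c"
    by (intro that[of "{i \<in> {..<n}. (p i, q i, r i) = (a, b, c)}"]) auto
  have "2 \<le> card C" using C(2) by simp
  then obtain T where T: "T \<subseteq> C" "card T = 2" using obtain_subset_with_card_n by metis
  then obtain s t where st: "T = {s, t}" "s \<noteq> t" by (meson card_2_iff)
  have stC: "s \<in> C" "t \<in> C" "s < n" "t < n" using T st C(1) by auto
  define \<alpha> where "\<alpha> = a - b"
  define \<beta> where "\<beta> = a - c"
  have eq: "p i - q i = \<alpha> \<and> p i - r i = \<beta>" if "i \<in> C" for i
    using abc[OF that] by (simp add: \<alpha>_def \<beta>_def)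

  have diff: "p i - q i \<in> fractions (M * M)" "p i - r i \<in> fractions (M * M)"
    "\<bar>p i - q i\<bar> \<le> 4 * real M" "\<bar>p i - r i\<bar> \<le> 4 * real M" if "i < n" for i
    using p[OF that] q[OF that] r[OF that] by (auto simp: bounded_fractions_def intro: fractions_diff)
  have gap: "1 / real (M ^ 4) \<le> \<bar>x - y\<bar>"
    if "x \<in> fractions (M * M)" "y \<in> fractions (M * M)" "x \<noteq> y" for x y
    using fractions_abs_ge[OF fractions_diff[OF that(1,2)]] that(3) by (simp add: power4_eq_xxxx mult.assoc)
  have \<alpha>: "\<alpha> \<in> fractions (M * M)" "\<bar>\<alpha>\<bar> \<le> 4 * real M"
    and \<beta>: "\<beta> \<in> fractions (M * M)" "\<bar>\<beta>\<bar> \<le> 4 * real M"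
    using diff[of s] eq[of s] stC by auto
  have L: "real L * (1 / real (M ^ 4)) = 4 * real M"
    using M by (simp add: L_def field_simps eval_nat_numeral)

  define B where "B = {i. i < n \<and> p i - q i \<noteq> \<alpha>} \<union> {i. i < n \<and> p i - r i \<noteq> \<beta>}"
  have "card {i. i < n \<and> p i - q i \<noteq> \<alpha>} < 2 * L"
    using diff(1) \<alpha> gap L by (intro deviating_card_less[OF C eq Lk]) auto
  moreover have "card {i. i < n \<and> p i - r i \<noteq> \<beta>} < 2 * L"
    using diff(2) \<beta> gap L eq
    by (intro level_between_halfspaces.deviating_card_less[OF level_between_halfspaces_swap C _ Lk]) auto
  ultimately have "card B \<le> 4 * L"
    using card_Un_le[of "{i. i < n \<and> p i - q i \<noteq> \<alpha>}" "{i. i < n \<and> p i - r i \<noteq> \<beta>}"]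
    unfolding B_def by linarith
  then have cB: "real (card B) \<le> 16 * real M ^ 5"
    unfolding L_def using of_nat_mono by fastforce

  have "card ({..<n} - {s, t}) = n - 2" using st stC by (simp add: card_Diff_subset)
  then have "k - 1 \<le> card ({..<n} - {s, t})" using Lk by linarith
  then obtain E where E: "E \<subseteq> {..<n} - {s, t}" "card E = k - 1" "finite E"
    by (metis obtain_subset_with_card_n)
  define X where "X = insert s E"
  have X: "X \<subseteq> {..<n}" "card X = k" "s \<in> X" "t \<notin> X"
  proof -
    have "s \<notin> E" using E(1) by auto
    then show "card X = k" using E(2,3) Lk by (simp add: X_def)
  qed (use E(1) st stC in \<open>auto simp: X_def\<close>)
  have mb: "margin n p q X < \<bar>\<alpha>\<bar>" "margin n p r X < \<bar>\<beta>\<bar>" "\<alpha> * \<beta> < 0"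
    using margin_bounds[OF X(1-3) stC(4) X(4)] eq stC by auto
  then have nz: "\<alpha> \<noteq> 0" "\<beta> \<noteq> 0" by auto
  define \<gamma> where "\<gamma> = \<bar>\<alpha>\<bar> * \<bar>\<beta>\<bar>"
  have ge: "1 / real (M * M) \<le> \<bar>\<alpha>\<bar>" "1 / real (M * M) \<le> \<bar>\<beta>\<bar>"
    using fractions_abs_ge \<alpha> \<beta> nz by blast+
  have \<gamma>: "1 \<le> real M ^ 4 * \<gamma>"
  proof -
    have "1 / real (M * M) * (1 / real (M * M)) \<le> \<gamma>"
      unfolding \<gamma>_def using ge by (intro mult_mono) auto
    then show ?thesis using M by (simp add: field_simps power4_eq_xxxx)
  qed
  have \<gamma>0: "0 < \<gamma>" using nz by (simp add: \<gamma>_def)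
  have "\<bar>\<beta>\<bar> * margin n p q X + \<bar>\<alpha>\<bar> * margin n p r X < \<bar>\<beta>\<bar> * \<bar>\<alpha>\<bar> + \<bar>\<alpha>\<bar> * \<bar>\<beta>\<bar>"
    using mb nz by (intro add_strict_mono mult_strict_left_mono) auto
  then have upper: "\<bar>\<beta>\<bar> * margin n p q X + \<bar>\<alpha>\<bar> * margin n p r X < 2 * \<gamma>"
    by (simp add: \<gamma>_def)
  have "(real n - real (card B)) * (\<bar>\<alpha>\<bar> * \<bar>\<beta>\<bar> * (1 / real (M * M))) - real (card B) * (2 * (4 * real M) ^ 3)
    \<le> \<bar>\<beta>\<bar> * margin n p q X + \<bar>\<alpha>\<bar> * margin n p r X"
  proof (rule weighted_margin_ge[OF X(1) mb(3) _ _ _ \<alpha>(2) \<beta>(2) ge])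
    fix i assume "i < n"
    moreover from this have "\<bar>p i\<bar> \<le> 2 * real M" using p by (simp add: bounded_fractions_def)
    then have "\<bar>of_bool (i \<in> X) - p i\<bar> \<le> 4 * real M" using M by (auto simp: of_bool_def)
    ultimately show "\<bar>p i - q i\<bar> \<le> 4 * real M \<and> \<bar>p i - r i\<bar> \<le> 4 * real M
        \<and> \<bar>of_bool (i \<in> X) - p i\<bar> \<le> 4 * real M"
      using diff by blast
  qed (auto simp: B_def)
  with upper have "(real n - real (card B)) * (\<gamma> / (real M)\<^sup>2) < 2 * \<gamma> + real (card B) * (128 * real M ^ 3)"
    by (simp add: \<gamma>_def power_mult_distrib power2_eq_square)
  also have "\<dots> \<le> 2 * \<gamma> + real (card B) * (128 * real M ^ 3) * (real M ^ 4 * \<gamma>)"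
    using \<gamma> mult_left_mono[OF \<gamma>, of "real (card B) * (128 * real M ^ 3)"] by simp
  also have "\<dots> = (2 * (real M)\<^sup>2 + real (card B) * (128 * real M ^ 9)) * (\<gamma> / (real M)\<^sup>2)"
    using M by (simp add: field_simps power2_eq_square eval_nat_numeral)
  finally have "real n - real (card B) < 2 * (real M)\<^sup>2 + real (card B) * (128 * real M ^ 9)"
    using \<gamma>0 M by (subst (asm) mult_less_cancel_right_pos) auto
  also have "\<dots> \<le> 2 * (real M)\<^sup>2 + (16 * real M ^ 5) * (128 * real M ^ 9)"
    using cB by (intro add_left_mono mult_right_mono) auto
  also have "\<dots> = 2 * (real M)\<^sup>2 + 2048 * real M ^ 14" by (simp flip: power_add)
  finally have "real n < 2 * (real M)\<^sup>2 + 2048 * real M ^ 14 + 16 * real M ^ 5"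
    using cB by linarith
  moreover have "(real M)\<^sup>2 \<le> real M ^ 14" "real M ^ 5 \<le> real M ^ 14" "0 \<le> real M ^ 14"
    using M by (auto intro!: power_increasing)
  moreover have "4096 * real M ^ 14 < real n"
    using M14 by (metis of_nat_less_iff of_nat_mult of_nat_numeral of_nat_power)
  ultimately show False by linarith
qed

end

lemma RES_ge_1: "1 \<le> RES x"
proof -
  obtain a b where ab: "quotient_of x = (a, b)" by fastforce
  then have "0 < b" by (rule quotient_of_denom_pos)
  then have "1 \<le> log 2 \<bar>real_of_int (b + 1)\<bar>" by (simp add: le_log_iff)
  then show ?thesis unfolding RES_def ab by (simp add: le_ceiling_iff le_max_iff_disj)
qed

lemma of_rat_bounded_fractions:
  assumes "RES x \<le> int m"
  shows "of_rat x \<in> bounded_fractions (2 ^ m)"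
proof -
  obtain a b where ab: "quotient_of x = (a, b)" by fastforce
  have b: "0 < b" using ab by (rule quotient_of_denom_pos)
  have x: "of_rat x = real_of_int a / real_of_int b"
    using quotient_of_div[OF ab] by (simp add: of_rat_divide)
  have "max (log 2 \<bar>real_of_int (a + 1)\<bar>) (log 2 \<bar>real_of_int (b + 1)\<bar>) \<le> real m"
    using assms unfolding RES_def ab by (simp add: ceiling_le_iff)
  then have la: "log 2 \<bar>real_of_int (a + 1)\<bar> \<le> real m" and lb: "log 2 \<bar>real_of_int (b + 1)\<bar> \<le> real m"
    by auto
  have "real_of_int (b + 1) \<le> 2 ^ m"
    using lb b by (simp add: log_le_iff powr_realpow)
  then have "b + 1 \<le> 2 ^ m" by (metis of_int_le_iff of_int_numeral of_int_power)
  then have bm: "nat b \<le> 2 ^ m" by (simp add: nat_le_iff)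
  have "\<bar>real_of_int (a + 1)\<bar> \<le> 2 ^ m"
  proof (cases "a + 1 = 0")
    case False
    then have "0 < \<bar>real_of_int (a + 1)\<bar>" by linarith
    then show ?thesis using la by (simp add: log_le_iff powr_realpow)
  qed simp
  moreover have "(1::real) \<le> 2 ^ m" by simp
  ultimately have "\<bar>real_of_int a\<bar> \<le> 2 * 2 ^ m" by linarith
  moreover have "\<bar>real_of_int a / real_of_int b\<bar> \<le> \<bar>real_of_int a\<bar> / 1"
    unfolding abs_divide using b by (intro divide_left_mono) auto
  ultimately have "\<bar>of_rat x\<bar> \<le> 2 * real (2 ^ m)" unfolding x by simp
  moreover have "of_rat x = real_of_int a / real (nat b)" "1 \<le> nat b" using x b by auto
  ultimately show ?thesis using bm unfolding bounded_fractions_def fractions_def by blast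
qed

lemma NN_resolution_upper:
  assumes fin: "finite (P \<union> N)"
    and v: "v \<in> P \<union> N" "i < dim_vec v" "v $ i = of_rat x"
  shows "RES x \<le> NN_resolution P N"
proof -
  let ?R = "{RES r | r v i. v \<in> P \<union> N \<and> i < dim_vec v \<and> v $ i = of_rat r}"
  have "?R \<subseteq> (\<Union>v\<in>P \<union> N. (\<lambda>i. RES (THE r. v $ i = of_rat r)) ` {..<dim_vec v})"
  proof
    fix y assume "y \<in> ?R"
    then obtain r v i where y: "y = RES r" "v \<in> P \<union> N" "i < dim_vec v" "v $ i = of_rat r"
      by blast
    then have "(THE r. v $ i = of_rat r) = r" by (intro the_equality) auto
    with y show "y \<in> (\<Union>v\<in>P \<union> N. (\<lambda>i. RES (THE r. v $ i = of_rat r)) ` {..<dim_vec v})" by blast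
  qed
  then have "finite ?R" by (rule finite_subset) (use fin in auto)
  moreover have "RES x \<in> ?R" using v by blast
  ultimately show ?thesis unfolding NN_resolution_def by (rule Max_ge)
qed

lemma anchor_entry_bounded:
  assumes "finite (P \<union> N)" "\<forall>v \<in> P \<union> N. rational_vec v" "v \<in> P \<union> N" "i < dim_vec v"
  shows "v $ i \<in> bounded_fractions (2 ^ nat (NN_resolution P N))"
    and "1 \<le> NN_resolution P N"
proof -
  have "v $ i \<in> \<rat>" using assms by (auto simp: rational_vec_def)
  then obtain x where x: "v $ i = of_rat x" by (auto elim: Rats_cases)
  have le: "RES x \<le> NN_resolution P N"
    using NN_resolution_upper[OF assms(1,3,4) x] .
  then show 1: "1 \<le> NN_resolution P N" using RES_ge_1[of x] by linarith
  show "v $ i \<in> bounded_fractions (2 ^ nat (NN_resolution P N))"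
    unfolding x using le 1 by (intro of_rat_bounded_fractions) simp
qed

lemma exact_level_representation:
  assumes rep: "NN_representation n (exact_level n) P N" and A: "A \<subseteq> {..<n}"
  shows "card A = n div 2 + 1 \<Longrightarrow> \<exists>p\<in>P. \<forall>q\<in>N. 0 < margin n (($) p) (($) q) A"
    and "card A \<noteq> n div 2 + 1 \<Longrightarrow> \<exists>q\<in>N. \<forall>p\<in>P. margin n (($) p) (($) q) A < 0"
proof -
  have c: "num_ones (vertex n A) = card A" using A by (rule num_ones_vertex)
  show "\<exists>p\<in>P. \<forall>q\<in>N. 0 < margin n (($) p) (($) q) A" if "card A = n div 2 + 1"
    using rep that c vertex_in_cube[of n A]
    by (simp add: NN_representation_def exact_level_def flip: euclid_dist_vertex_less_iff[OF A])
  show "\<exists>q\<in>N. \<forall>p\<in>P. margin n (($) p) (($) q) A < 0" if "card A \<noteq> n div 2 + 1"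
  proof -
    have "margin n (($) p) (($) q) A < 0 \<longleftrightarrow>
        euclid_dist (vertex n A) q < euclid_dist (vertex n A) p" for p q
      using margin_swap[of n "($) q" "($) p" A] by (simp add: euclid_dist_vertex_less_iff[OF A])
    then show ?thesis
      using rep that c vertex_in_cube[of n A]
      by (simp add: NN_representation_def exact_level_def)
  qed
qed

lemma no_two_positive_anchors:
  assumes rep: "NN_representation n (exact_level n) P {q}" and n: "3 \<le> n"
  shows "card P \<noteq> 2"
proof
  assume "card P = 2"
  define k where "k = n div 2 + 1"
  have k: "2 \<le> k" "k + 1 \<le> n" using n by (auto simp: k_def)
  let ?Y = "\<lambda>j. {..<k + 1} - {j}"
  have Y: "?Y j \<subseteq> {..<n}" "card (?Y j) = k" if "j < 3" for j
    using k that by auto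
  have ex: "\<exists>p\<in>P. 0 < margin n (($) p) (($) q) (?Y j)" if "j < 3" for j
    using exact_level_representation(1)[OF rep Y(1)] Y(2) that by (auto simp: k_def)
  then obtain g where g: "\<And>j. j < 3 \<Longrightarrow> g j \<in> P \<and> 0 < margin n (($) (g j)) (($) q) (?Y j)"
    by metis
  have "card (g ` {..<3::nat}) \<le> card P"
    using g rep by (intro card_mono) (auto simp: NN_representation_def)
  then have "\<not> inj_on g {..<3::nat}" using \<open>card P = 2\<close> by (intro pigeonhole) simp
  then obtain i j where ij: "i < 3" "j < 3" "i \<noteq> j" "g i = g j"
    by (auto simp: inj_on_def)
  have "?Y i = ?Y j"
  proof (rule isolated_level_set_unique)
    show "card (?Y i) = k" "card (?Y j) = k" using Y ij by auto
    show "0 < margin n (($) (g i)) (($) q) (?Y i)" using g[of i] ij by auto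
    show "0 < margin n (($) (g i)) (($) q) (?Y j)" using g[of j] ij by auto
    fix Z assume "Z \<subseteq> ?Y i \<union> ?Y j" "card Z \<noteq> k"
    then have "margin n (($) (g i)) (($) q) Z < 0"
      using exact_level_representation(2)[OF rep, of Z] Y(1)[OF ij(1)] Y(1)[OF ij(2)] g[OF ij(1)]
      unfolding k_def by blast
    then show "margin n (($) (g i)) (($) q) Z \<le> 0" by simp
  qed auto
  moreover have "j \<in> ?Y i" "j \<notin> ?Y j" using ij k by auto
  ultimately show False by blast
qed

lemma exact_level_dimension_le:
  assumes rep: "NN_representation n (exact_level n) P N" and c3: "card (P \<union> N) = 3"
    and rat: "\<forall>v \<in> P \<union> N. rational_vec v" and n: "3 \<le> n"
  shows "n \<le> (2 ^ nat (NN_resolution P N)) ^ 26" "1 \<le> NN_resolution P N"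
proof -
  have fin: "finite P" "finite N" and disj: "P \<inter> N = {}"
    and dim: "\<And>v. v \<in> P \<union> N \<Longrightarrow> dim_vec v = n"
    using rep by (auto simp: NN_representation_def)
  have sum3: "card P + card N = 3" using c3 fin disj by (simp add: card_Un_disjoint)
  have "P \<noteq> {}"
    using exact_level_representation(1)[OF rep, of "{..<n div 2 + 1}"] n by fastforce
  moreover have "N \<noteq> {}"
    using exact_level_representation(2)[OF rep, of "{}"] by auto
  ultimately have "0 < card P" "0 < card N" using fin by (auto simp: card_gt_0_iff)
  moreover have "card N \<noteq> 1"
    using no_two_positive_anchors[of n P] rep n sum3 by (auto simp: card_1_singleton_iff)
  ultimately have "card P = 1" "card N = 2" using sum3 by linarith+
  then obtain p q r where PN: "P = {p}" "N = {q, r}" by (metis card_1_singletonE card_2_iff)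
  have bnd: "v $ i \<in> bounded_fractions (2 ^ nat (NN_resolution P N))" "1 \<le> NN_resolution P N"
    if "v \<in> P \<union> N" "i < n" for v i
    using anchor_entry_bounded[of P N v i] fin rat dim that by auto
  show R: "1 \<le> NN_resolution P N" using bnd(2)[of p 0] PN n by auto
  interpret level_between_halfspaces n "n div 2 + 1" "($) p" "($) q" "($) r"
    using exact_level_representation[OF rep] unfolding PN by unfold_locales auto
  have "(2::nat) ^ 1 \<le> 2 ^ nat (NN_resolution P N)" using R by (intro power_increasing) auto
  then show "n \<le> (2 ^ nat (NN_resolution P N)) ^ 26"
    using bnd(1) PN by (intro dimension_le_power) auto
qed

theorem theorem7:
  "\<exists>c::real. c > 0 \<and> (\<exists>n\<^sub>0::nat. \<forall>n\<ge>n\<^sub>0. \<forall>P N.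
     NN_representation n (exact_level n) P N \<longrightarrow>
     card (P \<union> N) = 3 \<longrightarrow>
     (\<forall>v \<in> P \<union> N. rational_vec v) \<longrightarrow>
     c * log 2 (real n) \<le> real_of_int (NN_resolution P N))"
proof (intro exI conjI allI impI)
  show "0 < (1 / 26 :: real)" by simp
  fix n P N
  assume n: "(3::nat) \<le> n" and rep: "NN_representation n (exact_level n) P N"
    and c3: "card (P \<union> N) = 3" and rat: "\<forall>v \<in> P \<union> N. rational_vec v"
  define m where "m = nat (NN_resolution P N)"
  have "n \<le> 2 ^ (m * 26)" and m: "real_of_int (NN_resolution P N) = real m"
    using exact_level_dimension_le[OF rep c3 rat n] by (simp_all add: m_def power_mult)
  then have "real n \<le> 2 powr real (m * 26)"
    by (metis of_nat_le_iff of_nat_numeral of_nat_power powr_realpow zero_less_numeral)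
  then have "log 2 (real n) \<le> real (m * 26)" using n by (simp add: log_le_iff)
  then show "1 / 26 * log 2 (real n) \<le> real_of_int (NN_resolution P N)"
    unfolding m by simp
qed

end
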